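(* Let $\mathbf{C}=(C_1,\dots,C_8)\in\mathrm{S}(\ell,q)^8$ be a tuple of independent uniformly random symmetric $\ell\times\ell$ matrices over $\mathbb{F}_q$. Then $|\mathrm{Aut}(\mathbf{C})|\leq q^\ell$ for all but at most a $\frac{1}{q^{\Omega(\ell)}}$ fraction of such $\mathbf{C}$.
   Context: $\mathrm{S}(\ell,q)$ denotes the space of $\ell\times\ell$ symmetric matrices over $\mathbb{F}_q$. For a matrix tuple $\mathbf{C}=(C_1,\dots,C_8)$, $\mathrm{Aut}(\mathbf{C})=\{R\in\mathrm{GL}(\ell,\mathbb{F}_q): R^{T}C_iR=C_i \text{ for all } i\in[8]\}$. *)

theory Defs
  imports Complex_Main "HOL-Library.FuncSet" "HOL-Algebra.Ring" "Jordan_Normal_Form.Matrix"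
begin

text \<open>
  The constants hidden in \<open>\<Omega>(\<ell>)\<close> must not depend on \<open>q\<close>, so the finite field has to be quantified
  inside the statement, below these constants. A type of class \<^class>\<open>field\<close> cannot be quantified
  there; the field is therefore a ring structure \<open>F\<close> with an explicit finite carrier. A carrier type
  as large as \<^typ>\<open>nat\<close> already contains a copy of every finite field, so the constants are
  uniform over all prime powers \<open>q\<close>. The type of matrices is used only as a container: its
  arithmetic needs type classes, so the product and the identity over \<open>F\<close> are defined here.
\<close>

definition mats :: "('a, 'm) ring_scheme \<Rightarrow> nat \<Rightarrow> 'a mat set" where
  "mats F l = {A \<in> carrier_mat l l. \<forall>i<l. \<forall>j<l. A $$ (i, j) \<in> carrier F}"

definition mmult :: "('a, 'm) ring_scheme \<Rightarrow> 'a mat \<Rightarrow> 'a mat \<Rightarrow> 'a mat" where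
  "mmult F A B = mat (dim_row A) (dim_col B)
     (\<lambda>(i, j). \<Oplus>\<^bsub>F\<^esub>k\<in>{..<dim_col A}. A $$ (i, k) \<otimes>\<^bsub>F\<^esub> B $$ (k, j))"

definition mone :: "('a, 'm) ring_scheme \<Rightarrow> nat \<Rightarrow> 'a mat" where
  "mone F l = mat l l (\<lambda>(i, j). if i = j then \<one>\<^bsub>F\<^esub> else \<zero>\<^bsub>F\<^esub>)"

definition GL :: "('a, 'm) ring_scheme \<Rightarrow> nat \<Rightarrow> 'a mat set" where
  "GL F l = {R \<in> mats F l. \<exists>T \<in> mats F l. mmult F R T = mone F l \<and> mmult F T R = mone F l}"

definition sym_mats :: "('a, 'm) ring_scheme \<Rightarrow> nat \<Rightarrow> 'a mat set" where
  "sym_mats F l = {A \<in> mats F l. transpose_mat A = A}"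

definition sym_tuples :: "('a, 'm) ring_scheme \<Rightarrow> nat \<Rightarrow> (nat \<Rightarrow> 'a mat) set" where
  "sym_tuples F l = {1..8} \<rightarrow>\<^sub>E sym_mats F l"

definition Aut :: "('a, 'm) ring_scheme \<Rightarrow> nat \<Rightarrow> (nat \<Rightarrow> 'a mat) \<Rightarrow> 'a mat set" where
  "Aut F l C = {R \<in> GL F l. \<forall>i\<in>{1..8}. mmult F (mmult F (transpose_mat R) (C i)) R = C i}"

end

theory Submission
  imports Defs
begin

text \<open>
  By Markov's inequality it suffices to bound the expectation of \<open>|Aut(C)|\<close>, which is the sum over all
  invertible \<open>R\<close> of \<open>(|Fix R| / |Sym|)^8\<close>, where \<open>Fix R\<close> consists of the symmetric forms invariant
  under \<open>R\<close>. Choose greedily vectors \<open>x\<^sub>1, \<dots>, x\<^sub>k\<close> with \<open>k \<le> m = \<lfloor>l/4\<rfloor>\<close> such that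
  \<open>x\<^sub>1, R x\<^sub>1, \<dots>, x\<^sub>k, R x\<^sub>k\<close> are linearly independent, and let \<open>W\<close> be their span.

  An invariant form \<open>A\<close> satisfies \<open>A(R x\<^sub>i, R y) = A(x\<^sub>i, y)\<close>, so its values on \<open>R x\<^sub>i\<close> are determined by
  those on \<open>x\<^sub>i\<close>. Hence adding to invariant forms the forms \<open>\<Sum>\<^sub>i f\<^sub>i g\<^sub>i\<^sup>T + g\<^sub>i f\<^sub>i\<^sup>T\<close>, with \<open>f\<^sub>i\<close> dual to
  \<open>R x\<^sub>i\<close> and \<open>g\<^sub>i\<close> vanishing on \<open>W\<close>, is injective, which shows \<open>|Fix R| \<le> |Sym| / q^(k(l-2k))\<close>.

  If the choice stops at some \<open>k < m\<close>, then \<open>R x \<in> \<langle>x\<rangle> + W\<close> for every \<open>x\<close> outside \<open>W\<close>, so \<open>R\<close> is a scalar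
  modulo \<open>W\<close>, i.e. a scalar plus a matrix of rank at most \<open>2k\<close>. There are at most \<open>q^(1+4kl)\<close> such
  matrices and \<open>8k(l-2k) \<ge> 4kl\<close>, so each \<open>k < m\<close> contributes at most \<open>q\<close> to the expectation; \<open>k = m\<close>
  contributes at most \<open>q^9\<close> since there are only \<open>q^(l\<^sup>2)\<close> matrices.
\<close>

section \<open>Linear algebra over a finite field inside a commutative ring\<close>

text \<open>
  Stated for a subset of a type of class \<^class>\<open>comm_ring\<close> with its own unit \<open>u\<close>, so that sums and ring
  identities need no membership side conditions. Vectors and matrices are functions that vanish
  outside the index range.
\<close>

locale finite_field_subset =
  fixes K :: "'b::comm_ring set" and u :: 'b and l :: nat
  assumes finite_K: "finite K"
    and zero_K [simp]: "0 \<in> K"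
    and add_K: "x \<in> K \<Longrightarrow> y \<in> K \<Longrightarrow> x + y \<in> K"
    and uminus_K: "x \<in> K \<Longrightarrow> - x \<in> K"
    and mult_K: "x \<in> K \<Longrightarrow> y \<in> K \<Longrightarrow> x * y \<in> K"
    and unit_K [simp]: "u \<in> K"
    and unit_nonzero: "u \<noteq> 0"
    and unit_mult [simp]: "x \<in> K \<Longrightarrow> u * x = x"
    and inverse_K: "x \<in> K \<Longrightarrow> x \<noteq> 0 \<Longrightarrow> \<exists>y\<in>K. y * x = u"
begin

section \<open>Closure rules and cancellation in the field\<close>

lemma diff_K: "x \<in> K \<Longrightarrow> y \<in> K \<Longrightarrow> x - y \<in> K"
  using add_K[of x "- y"] uminus_K[of y] by simp

lemma sum_K: "(\<And>i. i \<in> A \<Longrightarrow> f i \<in> K) \<Longrightarrow> sum f A \<in> K"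
  by (induction A rule: infinite_finite_induct) (auto intro: add_K)

lemmas K_closed = add_K uminus_K mult_K diff_K sum_K

lemma no_zero_divisors_K:
  assumes "x \<in> K" "y \<in> K" "x * y = 0" "x \<noteq> 0"
  shows "y = 0"
proof -
  obtain z where z: "z \<in> K" "z * x = u"
    using inverse_K assms by blast
  have "y = (z * x) * y"
    using z assms by simp
  also have "\<dots> = z * (x * y)"
    by (simp add: mult.assoc)
  finally show ?thesis
    using assms by simp
qed

section \<open>Vectors, matrices, dual families and the projections they define\<close>

definition V :: "(nat \<Rightarrow> 'b) set" where
  "V = {x. \<forall>i. x i \<in> K \<and> (l \<le> i \<longrightarrow> x i = 0)}"

definition dot :: "(nat \<Rightarrow> 'b) \<Rightarrow> (nat \<Rightarrow> 'b) \<Rightarrow> 'b" where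
  "dot g x = (\<Sum>i<l. g i * x i)"

definition Mat :: "(nat \<Rightarrow> nat \<Rightarrow> 'b) set" where
  "Mat = {A. \<forall>i j. A i j \<in> K \<and> (l \<le> i \<or> l \<le> j \<longrightarrow> A i j = 0)}"

definition app :: "(nat \<Rightarrow> nat \<Rightarrow> 'b) \<Rightarrow> (nat \<Rightarrow> 'b) \<Rightarrow> nat \<Rightarrow> 'b" where
  "app A x i = (\<Sum>j<l. A i j * x j)"

text \<open>For biorthogonal \<open>w\<close> and \<open>\<phi>\<close> this is the projection along the span of \<open>w\<close>.\<close>

definition proj :: "nat \<Rightarrow> (nat \<Rightarrow> nat \<Rightarrow> 'b) \<Rightarrow> (nat \<Rightarrow> nat \<Rightarrow> 'b) \<Rightarrow> (nat \<Rightarrow> 'b) \<Rightarrow> nat \<Rightarrow> 'b" where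
  "proj n w \<phi> v i = v i - (\<Sum>a<n. dot (\<phi> a) v * w a i)"

definition biorth :: "nat \<Rightarrow> (nat \<Rightarrow> nat \<Rightarrow> 'b) \<Rightarrow> (nat \<Rightarrow> nat \<Rightarrow> 'b) \<Rightarrow> bool" where
  "biorth n w \<phi> \<longleftrightarrow> (\<forall>a<n. w a \<in> V \<and> \<phi> a \<in> V) \<and>
     (\<forall>a<n. \<forall>b<n. dot (\<phi> a) (w b) = (if a = b then u else 0))"

lemma V_K: "x \<in> V \<Longrightarrow> x i \<in> K"
  by (simp add: V_def)

lemma V_outside: "x \<in> V \<Longrightarrow> l \<le> i \<Longrightarrow> x i = 0"
  by (simp add: V_def)

lemma V_add: "x \<in> V \<Longrightarrow> y \<in> V \<Longrightarrow> (\<lambda>i. x i + y i) \<in> V"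
  by (simp add: V_def K_closed)

lemma V_diff: "x \<in> V \<Longrightarrow> y \<in> V \<Longrightarrow> (\<lambda>i. x i - y i) \<in> V"
  by (simp add: V_def K_closed)

lemma V_scale: "c \<in> K \<Longrightarrow> x \<in> V \<Longrightarrow> (\<lambda>i. c * x i) \<in> V"
  by (simp add: V_def K_closed)

lemma V_sum: "(\<And>a. a \<in> A \<Longrightarrow> x a \<in> V) \<Longrightarrow> (\<lambda>i. \<Sum>a\<in>A. x a i) \<in> V"
  by (auto simp: V_def intro!: K_closed)

lemma dot_K: "g \<in> V \<Longrightarrow> x \<in> V \<Longrightarrow> dot g x \<in> K"
  by (auto simp: dot_def V_def intro!: K_closed)

lemma dot_commute: "dot g x = dot x g"
  by (simp add: dot_def mult.commute)

lemma dot_add: "dot g (\<lambda>i. x i + y i) = dot g x + dot g y"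
  by (simp add: dot_def algebra_simps sum.distrib)

lemma dot_diff: "dot g (\<lambda>i. x i - y i) = dot g x - dot g y"
  by (simp add: dot_def algebra_simps sum_subtractf)

lemma dot_scale: "dot g (\<lambda>i. c * x i) = c * dot g x"
  by (simp add: dot_def sum_distrib_left algebra_simps)

lemma dot_sum: "dot g (\<lambda>i. \<Sum>a\<in>A. x a i) = (\<Sum>a\<in>A. dot g (x a))"
  unfolding dot_def sum_distrib_left by (rule sum.swap)

lemma dot_zero [simp]: "dot g (\<lambda>i. 0) = 0"
  by (simp add: dot_def)

lemmas dot_linear = dot_add dot_diff dot_scale dot_sum

lemma unit_vector_V: "j < l \<Longrightarrow> (\<lambda>i. if i = j then u else 0) \<in> V"
  by (auto simp: V_def)

lemma dot_unit_vector:
  assumes "g \<in> V" "j < l"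
  shows "dot g (\<lambda>i. if i = j then u else 0) = g j"
proof -
  have "dot g (\<lambda>i. if i = j then u else 0) = (\<Sum>i<l. if i = j then g i * u else 0)"
    unfolding dot_def by (rule sum.cong) auto
  also have "\<dots> = u * g j"
    using assms by (simp add: mult.commute)
  finally show ?thesis
    using assms V_K by simp
qed

lemma dot_nondegenerate:
  assumes "g \<in> V" "\<And>z. z \<in> V \<Longrightarrow> dot g z = 0"
  shows "g = (\<lambda>i. 0)"
proof
  fix i
  show "g i = 0"
    using assms dot_unit_vector[of g i] unit_vector_V[of i] V_outside[of g i]
    by (cases "i < l") auto
qed

lemma app_V: "A \<in> Mat \<Longrightarrow> x \<in> V \<Longrightarrow> app A x \<in> V"
  by (auto simp: V_def Mat_def app_def intro!: K_closed)

lemma app_add: "app A (\<lambda>i. x i + y i) = (\<lambda>i. app A x i + app A y i)"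
  by (simp add: app_def[abs_def] algebra_simps sum.distrib)

lemma app_unit_vector:
  assumes "A \<in> Mat" "j < l"
  shows "app A (\<lambda>i. if i = j then u else 0) = (\<lambda>i. A i j)"
proof
  fix i
  have "A i \<in> V"
    using assms by (auto simp: Mat_def V_def)
  then show "app A (\<lambda>i. if i = j then u else 0) i = A i j"
    using dot_unit_vector[of "A i" j] assms by (simp add: app_def dot_def)
qed

lemma biorth_V: "biorth n w \<phi> \<Longrightarrow> a < n \<Longrightarrow> w a \<in> V" "biorth n w \<phi> \<Longrightarrow> a < n \<Longrightarrow> \<phi> a \<in> V"
  by (simp_all add: biorth_def)

lemma biorth_dot:
  "biorth n w \<phi> \<Longrightarrow> a < n \<Longrightarrow> b < n \<Longrightarrow> dot (\<phi> a) (w b) = (if a = b then u else 0)"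
  by (simp add: biorth_def)

lemma proj_V:
  assumes "biorth n w \<phi>" "v \<in> V"
  shows "proj n w \<phi> v \<in> V"
  unfolding proj_def[abs_def]
  by (intro V_diff V_sum V_scale dot_K) (use assms biorth_V in auto)

lemma proj_add: "proj n w \<phi> (\<lambda>i. x i + y i) = (\<lambda>i. proj n w \<phi> x i + proj n w \<phi> y i)"
  by (simp add: proj_def[abs_def] dot_linear algebra_simps sum.distrib)

lemma proj_scale: "proj n w \<phi> (\<lambda>i. c * x i) = (\<lambda>i. c * proj n w \<phi> x i)"
  by (simp add: proj_def[abs_def] dot_linear algebra_simps sum_distrib_left)

lemma proj_zero: "proj n w \<phi> (\<lambda>i. 0) = (\<lambda>i. 0)"
  by (simp add: proj_def[abs_def])

lemma proj_sum:
  "finite A \<Longrightarrow> proj n w \<phi> (\<lambda>i. \<Sum>a\<in>A. x a i) = (\<lambda>i. \<Sum>a\<in>A. proj n w \<phi> (x a) i)"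
proof (induction A rule: finite_induct)
  case (insert a A)
  then show ?case
    using proj_add[of n w \<phi> "x a" "\<lambda>i. \<Sum>a\<in>A. x a i"] by simp
qed (simp add: proj_zero)

lemma dot_proj:
  "dot g (proj n w \<phi> v) = dot g v - (\<Sum>a<n. dot (\<phi> a) v * dot g (w a))"
  by (simp add: proj_def[abs_def] dot_linear)

lemma dot_dual_proj:
  assumes "biorth n w \<phi>" "b < n" "v \<in> V"
  shows "dot (\<phi> b) (proj n w \<phi> v) = 0"
proof -
  have "(\<Sum>a<n. dot (\<phi> a) v * dot (\<phi> b) (w a)) = (\<Sum>a<n. if a = b then u * dot (\<phi> b) v else 0)"
    using assms by (intro sum.cong) (auto simp: biorth_dot mult.commute)
  also have "\<dots> = dot (\<phi> b) v"
    using assms biorth_V by (simp add: dot_K)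
  finally show ?thesis
    by (simp add: dot_proj)
qed

lemma proj_basis:
  assumes "biorth n w \<phi>" "b < n"
  shows "proj n w \<phi> (w b) = (\<lambda>i. 0)"
proof
  fix i
  have "(\<Sum>a<n. dot (\<phi> a) (w b) * w a i) = (\<Sum>a<n. if a = b then u * w b i else 0)"
    using assms by (intro sum.cong) (auto simp: biorth_dot)
  also have "\<dots> = w b i"
    using assms biorth_V V_K by simp
  finally show "proj n w \<phi> (w b) i = 0"
    by (simp add: proj_def)
qed

text \<open>Some coordinate \<open>i\<close> of the projection of \<open>x\<close> is nonzero.
  Suitably scaled, the functional taking \<open>v\<close> to coordinate \<open>i\<close> of its
  projection vanishes on the old vectors and is \<open>u\<close> at \<open>x\<close>, hence serves
  as the new dual vector. The second conclusion says that the kernel of the new projection is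
  contained in the span of the old vectors and \<open>x\<close>; its contrapositive certifies that a
  further vector is independent.\<close>

lemma biorth_extend:
  assumes b: "biorth n w \<phi>" and x: "x \<in> V" and nz: "proj n w \<phi> x \<noteq> (\<lambda>i. 0)"
  obtains \<psi> where "biorth (Suc n) (w(n := x)) \<psi>"
    and "\<And>v. v \<in> V \<Longrightarrow> proj (Suc n) (w(n := x)) \<psi> v = (\<lambda>i. 0) \<Longrightarrow>
           \<exists>c\<in>K. proj n w \<phi> v = (\<lambda>i. c * proj n w \<phi> x i)"
proof -
  obtain i where i: "proj n w \<phi> x i \<noteq> 0"
    using nz by auto
  have il: "i < l"
    using i proj_V[OF b x] V_outside by (meson not_le)
  obtain c where c: "c \<in> K" "c * proj n w \<phi> x i = u"
    using inverse_K[OF V_K[OF proj_V[OF b x]] i] by blast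
  \<comment> \<open>The vector representing the functional \<open>v\<close> to
    \<open>c * proj n w \<phi> v i\<close>: \<open>c\<close> times row \<open>i\<close> of the
    matrix of the projection.\<close>
  define g where "g = (\<lambda>j. c * ((if j = i then u else 0) - (\<Sum>a<n. w a i * \<phi> a j)))"
  have gV: "g \<in> V"
    unfolding g_def by (intro V_scale V_diff V_sum c unit_vector_V il) (use b biorth_V V_K in auto)
  have g: "dot g v = c * proj n w \<phi> v i" if "v \<in> V" for v
  proof -
    have "dot g v = c * (dot v (\<lambda>j. if j = i then u else 0) - (\<Sum>a<n. w a i * dot v (\<phi> a)))"
      by (subst dot_commute) (simp add: g_def dot_linear)
    also have "\<dots> = c * proj n w \<phi> v i"
      by (simp add: dot_unit_vector[OF that il] proj_def dot_commute mult.commute)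
    finally show ?thesis .
  qed
  \<comment> \<open>Subtracting \<open>dot (\<phi> a) x\<close> times \<open>g\<close> makes each
    old dual vector vanish at \<open>x\<close> without changing its values on the
    \<open>w a\<close>.\<close>
  define \<psi> where "\<psi> = (\<lambda>a. if a = n then g else (\<lambda>j. \<phi> a j - dot (\<phi> a) x * g j))"
  have gx: "dot g x = u"
    using g x c by simp
  have gw: "dot g (w a) = 0" if "a < n" for a
    using g[of "w a"] that proj_basis[OF b that] biorth_V[OF b that] by simp
  have \<psi>_dot: "dot (\<psi> a) v = dot (\<phi> a) v - dot (\<phi> a) x * dot g v" if "a < n" for a v
  proof -
    have "dot (\<psi> a) v = dot v (\<lambda>j. \<phi> a j - dot (\<phi> a) x * g j)"
      using that by (subst dot_commute) (simp add: \<psi>_def)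
    also have "\<dots> = dot (\<phi> a) v - dot (\<phi> a) x * dot g v"
      by (simp add: dot_linear dot_commute[of v])
    finally show ?thesis .
  qed
  have "\<psi> a \<in> V" if "a < Suc n" for a
    using that x gV biorth_V[OF b] by (auto simp: \<psi>_def less_Suc_eq intro!: V_diff V_scale dot_K)
  moreover have "dot (\<psi> a) ((w(n := x)) a') = (if a = a' then u else 0)"
    if "a < Suc n" "a' < Suc n" for a a'
  proof (cases "a = n")
    case True
    then show ?thesis
      using that gx gw by (auto simp: \<psi>_def less_Suc_eq)
  next
    case False
    then have "a < n"
      using that by simp
    moreover have "dot (\<phi> a) x * u = dot (\<phi> a) x"
      using b x \<open>a < n\<close> by (simp add: dot_K biorth_V mult.commute)
    ultimately show ?thesis
      using that gx gw b by (auto simp: \<psi>_dot less_Suc_eq biorth_dot)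
  qed
  ultimately have bi: "biorth (Suc n) (w(n := x)) \<psi>"
    using b x by (auto simp: biorth_def less_Suc_eq)
  moreover have "\<exists>d\<in>K. proj n w \<phi> v = (\<lambda>i. d * proj n w \<phi> x i)"
    if v: "v \<in> V" and z: "proj (Suc n) (w(n := x)) \<psi> v = (\<lambda>i. 0)" for v
  proof
    have "v i = (\<Sum>a<n. dot (\<psi> a) v * w a i) + dot (\<psi> n) v * x i" for i
      using fun_cong[OF z, of i] by (simp add: proj_def)
    then have "v = (\<lambda>i. (\<Sum>a<n. dot (\<psi> a) v * w a i) + dot (\<psi> n) v * x i)"
      by blast
    then have "proj n w \<phi> v = proj n w \<phi> (\<lambda>i. (\<Sum>a<n. dot (\<psi> a) v * w a i) + dot (\<psi> n) v * x i)"
      by (rule arg_cong)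
    also have "\<dots> = (\<lambda>i. dot (\<psi> n) v * proj n w \<phi> x i)"
      by (simp add: proj_add proj_sum proj_scale proj_basis[OF b])
    finally show "proj n w \<phi> v = (\<lambda>i. dot (\<psi> n) v * proj n w \<phi> x i)" .
    show "dot (\<psi> n) v \<in> K"
      using biorth_V(2)[OF bi, of n] v by (simp add: dot_K)
  qed
  ultimately show thesis
    using that by blast
qed

section \<open>Operators that are scalar modulo a subspace\<close>

lemma card_K_ge: "2 \<le> card K"
  using card_mono[OF finite_K, of "{0, u}"] unit_nonzero by simp

lemma V_eq_image: "V = (\<lambda>f i. if i < l then f i else 0) ` ({..<l} \<rightarrow>\<^sub>E K)" (is "_ = ?g ` _")
proof
  show "V \<subseteq> ?g ` ({..<l} \<rightarrow>\<^sub>E K)"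
  proof
    fix x assume "x \<in> V"
    then have "x = ?g (restrict x {..<l})" "restrict x {..<l} \<in> {..<l} \<rightarrow>\<^sub>E K"
      by (auto simp: V_def fun_eq_iff)
    then show "x \<in> ?g ` ({..<l} \<rightarrow>\<^sub>E K)"
      by blast
  qed
  show "?g ` ({..<l} \<rightarrow>\<^sub>E K) \<subseteq> V"
  proof (rule image_subsetI)
    fix f assume "f \<in> {..<l} \<rightarrow>\<^sub>E K"
    then have "f i \<in> K" if "i < l" for i
      using that by (intro PiE_mem[of f "{..<l}" "\<lambda>_. K" i]) auto
    then show "?g f \<in> V"
      by (simp add: V_def)
  qed
qed

lemma finite_V: "finite V"
  by (simp add: V_eq_image finite_PiE finite_K)

lemma card_V: "card V = card K ^ l"
proof -
  have "inj_on (\<lambda>f i. if i < l then f i else 0) ({..<l} \<rightarrow>\<^sub>E K)"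
  proof (rule inj_onI)
    fix f g :: "nat \<Rightarrow> 'b"
    assume fg: "f \<in> {..<l} \<rightarrow>\<^sub>E K" "g \<in> {..<l} \<rightarrow>\<^sub>E K"
      and eq: "(\<lambda>i. if i < l then f i else 0) = (\<lambda>i. if i < l then g i else 0)"
    have "f i = g i" if "i < l" for i
      using fun_cong[OF eq, of i] that by simp
    then show "f = g"
      using fg by (intro PiE_ext[of f "{..<l}" "\<lambda>_. K" g]) auto
  qed
  then show ?thesis
    by (simp add: V_eq_image card_image card_PiE)
qed

text \<open>If the projection killed all of \<open>V\<close>, every vector would be a combination of
  \<open>n\<close> vectors, leaving at most \<open>card K ^ n < card K ^ l\<close> of them.\<close>

lemma exists_proj_nonzero:
  assumes b: "biorth n w \<phi>" and "n < l"
  shows "\<exists>x\<in>V. proj n w \<phi> x \<noteq> (\<lambda>i. 0)"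
proof (rule ccontr)
  assume "\<not> ?thesis"
  then have z: "proj n w \<phi> x = (\<lambda>i. 0)" if "x \<in> V" for x
    using that by blast
  have "V \<subseteq> (\<lambda>c i. \<Sum>a<n. c a * w a i) ` ({..<n} \<rightarrow>\<^sub>E K)"
  proof
    fix x assume x: "x \<in> V"
    have "x i = (\<Sum>a<n. restrict (\<lambda>a. dot (\<phi> a) x) {..<n} a * w a i)" for i
      using fun_cong[OF z[OF x], of i] by (simp add: proj_def)
    moreover have "restrict (\<lambda>a. dot (\<phi> a) x) {..<n} \<in> {..<n} \<rightarrow>\<^sub>E K"
      using b x by (auto intro!: dot_K biorth_V(2))
    ultimately show "x \<in> (\<lambda>c i. \<Sum>a<n. c a * w a i) ` ({..<n} \<rightarrow>\<^sub>E K)"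
      by blast
  qed
  then have "card V \<le> card ({..<n} \<rightarrow>\<^sub>E K)"
    by (rule surj_card_le[rotated]) (simp add: finite_PiE finite_K)
  then have "card K ^ l \<le> card K ^ n"
    by (simp add: card_V card_PiE)
  then show False
    using power_strict_increasing[OF \<open>n < l\<close>, of "card K"] card_K_ge by simp
qed

section \<open>Operators with every vector an eigenvector modulo a span\<close>

lemma scaled_eq:
  assumes "c \<in> K" "d \<in> K" "c \<noteq> 0" "t \<in> V" and eq: "\<And>i. c * t i = d * s i"
  shows "\<exists>e\<in>K. t = (\<lambda>i. e * s i)"
proof -
  obtain b where b: "b \<in> K" "b * c = u"
    using inverse_K assms by blast
  have "t i = (b * d) * s i" for i
  proof -
    have "t i = (b * c) * t i"
      using b assms V_K by simp
    also have "\<dots> = b * (c * t i)"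
      by (simp add: mult.assoc)
    finally show ?thesis
      by (simp add: eq mult.assoc)
  qed
  then show ?thesis
    using mult_K[OF b(1) assms(2)] by blast
qed

text \<open>The classical fact that an operator for which every nonzero vector is an eigenvector is
  a scalar, applied modulo the span of \<open>w\<close>. Since \<open>n + 2 \<le> l\<close>, the
  quotient contains two independent classes, those of \<open>p\<close> and \<open>r\<close>. The
  assumption concerns only vectors outside the span, whereas the conclusion also covers those inside
  it.\<close>

lemma scalar_modulo_span:
  assumes b: "biorth n w \<phi>" and n: "n + 2 \<le> l" and R: "R \<in> Mat"
    and loc: "\<And>x. x \<in> V \<Longrightarrow> proj n w \<phi> x \<noteq> (\<lambda>i. 0) \<Longrightarrow>
      \<exists>c\<in>K. proj n w \<phi> (app R x) = (\<lambda>i. c * proj n w \<phi> x i)"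
  shows "\<exists>c\<in>K. \<forall>x\<in>V. proj n w \<phi> (app R x) = (\<lambda>i. c * proj n w \<phi> x i)"
proof -
  define Q where "Q = proj n w \<phi>"
  define B where "B x = Q (app R x)" for x
  have QV: "Q x \<in> V" if "x \<in> V" for x
    unfolding Q_def using b that by (rule proj_V)
  have Qadd: "Q (\<lambda>i. x i + y i) = (\<lambda>i. Q x i + Q y i)" for x y
    unfolding Q_def by (rule proj_add)
  have Badd: "B (\<lambda>i. x i + y i) = (\<lambda>i. B x i + B y i)" for x y
    unfolding B_def by (simp add: app_add Qadd)
  have loc: "\<exists>c\<in>K. B x = (\<lambda>i. c * Q x i)" if "x \<in> V" "Q x \<noteq> (\<lambda>i. 0)" for x
    using loc that unfolding B_def Q_def by blast
  obtain p where p: "p \<in> V" "Q p \<noteq> (\<lambda>i. 0)"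
    using exists_proj_nonzero[OF b] n by (auto simp: Q_def)
  obtain \<psi> where \<psi>: "biorth (Suc n) (w(n := p)) \<psi>"
    "\<And>v. v \<in> V \<Longrightarrow> proj (Suc n) (w(n := p)) \<psi> v = (\<lambda>i. 0) \<Longrightarrow>
           \<exists>c\<in>K. proj n w \<phi> v = (\<lambda>i. c * proj n w \<phi> p i)"
    using biorth_extend[OF b p(1)] p(2) unfolding Q_def by blast
  obtain r where r: "r \<in> V" "\<And>c. c \<in> K \<Longrightarrow> Q r \<noteq> (\<lambda>i. c * Q p i)"
  proof -
    \<comment> \<open>\<open>P\<close> kills the \<open>w a\<close> and \<open>p\<close>, and it
      factors through \<open>Q\<close>. If \<open>Q r\<close> were a multiple of \<open>Q p\<close>,
      then \<open>P r\<close> would be 0.\<close>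
    define P where "P = proj (Suc n) (w(n := p)) \<psi>"
    obtain r where r: "r \<in> V" "P r \<noteq> (\<lambda>i. 0)"
      using exists_proj_nonzero[OF \<psi>(1)] n by (auto simp: P_def)
    have P_Q: "P (Q v) = P v" for v
    proof -
      have "v = (\<lambda>i. Q v i + (\<Sum>a<n. dot (\<phi> a) v * (w(n := p)) a i))"
        by (simp add: Q_def proj_def)
      then have "P v = P (\<lambda>i. Q v i + (\<Sum>a<n. dot (\<phi> a) v * (w(n := p)) a i))"
        by (rule arg_cong)
      also have "\<dots> = P (Q v)"
        using proj_basis[OF \<psi>(1)]
        by (simp add: P_def proj_add proj_sum[of _ _ _ _ "\<lambda>a i. dot (\<phi> a) v * (w(n := p)) a i"]
            proj_scale del: fun_upd_apply)
      finally show ?thesis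
        by simp
    qed
    have P_p: "P p = (\<lambda>i. 0)"
      using proj_basis[OF \<psi>(1), of n] by (simp add: P_def)
    show thesis
    proof (rule that[OF r(1)])
      fix c assume "c \<in> K"
      show "Q r \<noteq> (\<lambda>i. c * Q p i)"
      proof
        assume "Q r = (\<lambda>i. c * Q p i)"
        then have "P (Q r) = (\<lambda>i. c * P (Q p) i)"
          by (simp add: P_def proj_scale)
        then show False
          using r(2) by (simp add: P_Q P_p)
      qed
    qed
  qed
  obtain c where c: "c \<in> K" "B p = (\<lambda>i. c * Q p i)"
    using loc[OF p] by blast
  \<comment> \<open>Compare the eigenvalues \<open>a\<close> of \<open>z\<close>, \<open>c\<close>
    of \<open>p\<close> and \<open>d\<close> of \<open>z + p\<close>: additivity gives
    \<open>(a - d) Q z = (d - c) Q p\<close>, and independence forces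
    \<open>a = d = c\<close>.\<close>
  have off: "B z = (\<lambda>i. c * Q z i)"
    if z: "z \<in> V" and nz: "\<And>d. d \<in> K \<Longrightarrow> Q z \<noteq> (\<lambda>i. d * Q p i)" for z
  proof -
    have "Q z \<noteq> (\<lambda>i. 0)"
      using nz[of 0] by simp
    then obtain a where a: "a \<in> K" "B z = (\<lambda>i. a * Q z i)"
      using loc z by blast
    have "(\<lambda>i. Q z i + Q p i) \<noteq> (\<lambda>i. 0)"
    proof
      assume "(\<lambda>i. Q z i + Q p i) = (\<lambda>i. 0)"
      then have s: "Q z i + Q p i = 0" for i
        by meson
      have "Q z i = (- u) * Q p i" for i
        using s[of i] QV[OF p(1)] V_K by (simp add: eq_neg_iff_add_eq_0)
      then show False
        using nz[of "- u"] by (auto simp: uminus_K)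
    qed
    then obtain d where d: "d \<in> K" "B (\<lambda>i. z i + p i) = (\<lambda>i. d * (Q z i + Q p i))"
      using loc[of "\<lambda>i. z i + p i"] V_add[OF z p(1)] unfolding Qadd by blast
    have eq: "(a - d) * Q z i = (d - c) * Q p i" for i
    proof -
      have "a * Q z i + c * Q p i = d * (Q z i + Q p i)"
        using fun_cong[OF d(2), of i] by (simp add: Badd a c)
      then show ?thesis
        by (simp add: algebra_simps)
    qed
    have "a = d"
    proof (rule ccontr)
      assume "a \<noteq> d"
      then have "\<exists>e\<in>K. Q z = (\<lambda>i. e * Q p i)"
        using a c d z QV eq by (intro scaled_eq[of "a - d" "d - c"]) (auto intro: K_closed)
      then show False
        using nz by blast
    qed
    obtain i where i: "Q p i \<noteq> 0"
      using p(2) by auto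
    have "Q p i * (d - c) = 0"
      using eq[of i] \<open>a = d\<close> by (simp add: mult.commute)
    then have "d = c"
      using no_zero_divisors_K[of "Q p i" "d - c"] i c d QV[OF p(1)] V_K diff_K by simp
    then show ?thesis
      using a \<open>a = d\<close> by simp
  qed
  have "B z = (\<lambda>i. c * Q z i)" if z: "z \<in> V" for z
  proof (cases "\<exists>d\<in>K. Q z = (\<lambda>i. d * Q p i)")
    case True
    then obtain d where d: "d \<in> K" "Q z = (\<lambda>i. d * Q p i)"
      by blast
    \<comment> \<open>Here \<open>Q z\<close> is a multiple of \<open>Q p\<close>, possibly 0, so
      \<open>off\<close> is applied to \<open>z + r\<close> and to \<open>r\<close> and the results
      are subtracted. The case \<open>Q z = 0\<close> shows that the span is mapped into
      itself.\<close>
    have "B (\<lambda>i. z i + r i) = (\<lambda>i. c * Q (\<lambda>i. z i + r i) i)"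
    proof (rule off)
      show "(\<lambda>i. z i + r i) \<in> V"
        using z r by (simp add: V_add)
      fix e assume e: "e \<in> K"
      show "Q (\<lambda>i. z i + r i) \<noteq> (\<lambda>i. e * Q p i)"
      proof
        assume eq: "Q (\<lambda>i. z i + r i) = (\<lambda>i. e * Q p i)"
        have "Q r i = (e - d) * Q p i" for i
          using fun_cong[OF eq, of i] d by (simp add: Qadd algebra_simps)
        then show False
          using r(2)[of "e - d"] e d by (auto simp: diff_K)
      qed
    qed
    moreover have "B r = (\<lambda>i. c * Q r i)"
      using off r by blast
    ultimately show ?thesis
      by (simp add: Badd Qadd algebra_simps fun_eq_iff)
  next
    case False
    then show ?thesis
      using off z by blast
  qed
  then show ?thesis
    using c unfolding B_def Q_def by blast
qed

text \<open>The vectors are interleaved: even indices hold the chosen \<open>x\<close>, and the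
  following odd index holds \<open>R x\<close>.\<close>

definition chain :: "(nat \<Rightarrow> nat \<Rightarrow> 'b) \<Rightarrow> nat \<Rightarrow> (nat \<Rightarrow> nat \<Rightarrow> 'b) \<Rightarrow> (nat \<Rightarrow> nat \<Rightarrow> 'b) \<Rightarrow> bool" where
  "chain R k w \<phi> \<longleftrightarrow> biorth (2 * k) w \<phi> \<and> (\<forall>i<k. w (2 * i + 1) = app R (w (2 * i)))"

text \<open>A scalar matrix plus a matrix of rank at most \<open>n\<close>, the latter written as
  \<open>n\<close> outer products. Being the image of a parameter set, it is counted at once,
  without a notion of rank.\<close>

definition near_scalar :: "nat \<Rightarrow> (nat \<Rightarrow> nat \<Rightarrow> 'b) set" where
  "near_scalar n = (\<lambda>(c, w, \<chi>) i j. if i < l \<and> j < l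
       then (if i = j then c else 0) + (\<Sum>a<n. w a i * \<chi> a j) else 0)
     ` (K \<times> ({..<n} \<rightarrow>\<^sub>E V) \<times> ({..<n} \<rightarrow>\<^sub>E V))"

lemma finite_near_scalar: "finite (near_scalar n)"
  unfolding near_scalar_def
  by (intro finite_imageI finite_cartesian_product finite_PiE finite_K finite_V) auto

lemma card_near_scalar: "card (near_scalar n) \<le> card K ^ (1 + 2 * n * l)"
proof -
  have "card (near_scalar n) \<le> card (K \<times> ({..<n} \<rightarrow>\<^sub>E V) \<times> ({..<n} \<rightarrow>\<^sub>E V))"
    unfolding near_scalar_def
    by (intro card_image_le finite_cartesian_product finite_PiE finite_K finite_V) auto
  also have "\<dots> = card K ^ (1 + 2 * n * l)"
    by (simp add: card_cartesian_product card_PiE card_V mult.commute mult_2_right power_add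
        distrib_left flip: power_mult)
  finally show ?thesis .
qed

text \<open>The hypothesis says that \<open>R\<close> minus the scalar \<open>c\<close> maps
  \<open>V\<close> into the span of \<open>w\<close>. Column \<open>j\<close> of this difference has
  coordinates \<open>\<chi> a j\<close>, obtained by applying \<open>\<phi> a\<close> to it.\<close>

lemma near_scalarI:
  assumes b: "biorth n w \<phi>" and R: "R \<in> Mat" and c: "c \<in> K"
    and eq: "\<And>x. x \<in> V \<Longrightarrow> proj n w \<phi> (app R x) = (\<lambda>i. c * proj n w \<phi> x i)"
  shows "R \<in> near_scalar n"
proof -
  define \<chi> where "\<chi> = (\<lambda>a j. if j < l then dot (\<phi> a) (\<lambda>i. R i j) - c * \<phi> a j else 0)"
  have col: "(\<lambda>i. R i j) \<in> V" for j
    using R by (auto simp: Mat_def V_def)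
  have \<chi>V: "\<chi> a \<in> V" if "a < n" for a
    using biorth_V(2)[OF b that] dot_K[OF biorth_V(2)[OF b that] col] c
    by (auto simp: \<chi>_def V_def intro!: K_closed)
  have ent: "R i j = (if i = j then c else 0) + (\<Sum>a<n. w a i * \<chi> a j)" if "i < l" "j < l" for i j
  proof -
    let ?x = "\<lambda>i. if i = j then u else 0"
    have x: "?x \<in> V"
      using that unit_vector_V by blast
    have d: "dot (\<phi> a) ?x = \<phi> a j" if "a < n" for a
      using dot_unit_vector[OF biorth_V(2)[OF b that] \<open>j < l\<close>] .
    have "proj n w \<phi> (\<lambda>i. R i j) i = c * proj n w \<phi> ?x i"
      using fun_cong[OF eq[OF x], of i] app_unit_vector[OF R \<open>j < l\<close>] by simp
    then have "R i j = c * ?x i - c * (\<Sum>a<n. dot (\<phi> a) ?x * w a i)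
        + (\<Sum>a<n. dot (\<phi> a) (\<lambda>i. R i j) * w a i)"
      by (simp add: proj_def algebra_simps split: if_splits)
    also have "\<dots> = c * ?x i + (\<Sum>a<n. w a i * \<chi> a j)"
      using that by (simp add: d \<chi>_def sum_distrib_left sum_subtractf algebra_simps)
    finally show ?thesis
      using c unit_mult[OF c] by (simp add: mult.commute)
  qed
  \<comment> \<open>The families are restricted to \<open>{..<n}\<close> to become members of the
    finite extensional parameter set.\<close>
  have "R = (\<lambda>i j. if i < l \<and> j < l
      then (if i = j then c else 0) + (\<Sum>a<n. restrict w {..<n} a i * restrict \<chi> {..<n} a j) else 0)"
    using R ent by (auto simp: fun_eq_iff Mat_def not_less)
  moreover have "restrict w {..<n} \<in> {..<n} \<rightarrow>\<^sub>E V" "restrict \<chi> {..<n} \<in> {..<n} \<rightarrow>\<^sub>E V"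
    using \<chi>V biorth_V[OF b] by auto
  ultimately show ?thesis
    using c unfolding near_scalar_def
    by (intro image_eqI[of _ _ "(c, restrict w {..<n}, restrict \<chi> {..<n})"]) auto
qed

text \<open>If some \<open>x\<close> has \<open>x\<close> and \<open>R x\<close> independent modulo
  the span, two applications of \<open>biorth_extend\<close> append them. Otherwise
  \<open>scalar_modulo_span\<close> applies.\<close>

lemma chain_extend_or_near_scalar:
  assumes ch: "chain R k w \<phi>" and l: "2 * k + 2 \<le> l" and R: "R \<in> Mat"
  shows "(\<exists>w' \<phi>'. chain R (Suc k) w' \<phi>') \<or> R \<in> near_scalar (2 * k)"
proof (rule disjCI)
  let ?Q = "proj (2 * k) w \<phi>"
  assume nN: "R \<notin> near_scalar (2 * k)"
  have b: "biorth (2 * k) w \<phi>"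
    using ch by (simp add: chain_def)
  obtain x where x: "x \<in> V" "?Q x \<noteq> (\<lambda>i. 0)" "\<And>c. c \<in> K \<Longrightarrow> ?Q (app R x) \<noteq> (\<lambda>i. c * ?Q x i)"
  proof (rule ccontr)
    assume "\<not> thesis"
    then have "\<And>x. x \<in> V \<Longrightarrow> ?Q x \<noteq> (\<lambda>i. 0) \<Longrightarrow> \<exists>c\<in>K. ?Q (app R x) = (\<lambda>i. c * ?Q x i)"
      using that by blast
    from scalar_modulo_span[OF b l R this]
    obtain c where "c \<in> K" "\<And>x. x \<in> V \<Longrightarrow> ?Q (app R x) = (\<lambda>i. c * ?Q x i)"
      by blast
    from near_scalarI[OF b R this] show False
      using nN by blast
  qed
  obtain \<psi> where \<psi>: "biorth (Suc (2 * k)) (w(2 * k := x)) \<psi>"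
    "\<And>v. v \<in> V \<Longrightarrow> proj (Suc (2 * k)) (w(2 * k := x)) \<psi> v = (\<lambda>i. 0) \<Longrightarrow>
           \<exists>c\<in>K. ?Q v = (\<lambda>i. c * ?Q x i)"
    using biorth_extend[OF b x(1,2)] by blast
  have "proj (Suc (2 * k)) (w(2 * k := x)) \<psi> (app R x) \<noteq> (\<lambda>i. 0)"
    using \<psi>(2)[OF app_V[OF R x(1)]] x(3) by blast
  then obtain \<psi>' where
    b': "biorth (Suc (Suc (2 * k))) ((w(2 * k := x))(Suc (2 * k) := app R x)) \<psi>'"
    using biorth_extend[OF \<psi>(1) app_V[OF R x(1)]] by blast
  have "chain R (Suc k) ((w(2 * k := x))(Suc (2 * k) := app R x)) \<psi>'"
    using ch b' by (auto simp: chain_def less_Suc_eq)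
  then show "\<exists>w' \<phi>'. chain R (Suc k) w' \<phi>'"
    by blast
qed

section \<open>Invariant symmetric forms\<close>

text \<open>Induction on \<open>m\<close>: a chain already known to be near scalar is kept, any
  other one has length exactly \<open>m\<close> and is extended. The bound on \<open>m\<close>
  leaves the two free dimensions needed for this.\<close>

lemma chain_maximal:
  assumes R: "R \<in> Mat" and m: "4 * m \<le> l"
  obtains k w \<phi> where "k \<le> m" "chain R k w \<phi>" "k = m \<or> R \<in> near_scalar (2 * k)"
proof -
  have "\<exists>k w \<phi>. k \<le> m \<and> chain R k w \<phi> \<and> (k = m \<or> R \<in> near_scalar (2 * k))"
    using m
  proof (induction m)
    case 0
    then show ?case
      by (auto simp: chain_def biorth_def)
  next
    case (Suc m)
    then obtain k w \<phi> where k: "k \<le> m" "chain R k w \<phi>" "k = m \<or> R \<in> near_scalar (2 * k)"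
      by auto
    show ?case
    proof (cases "R \<in> near_scalar (2 * k)")
      case True
      then show ?thesis
        using k le_SucI by blast
    next
      case False
      then have "k = m" "\<exists>w' \<phi>'. chain R (Suc k) w' \<phi>'"
        using k chain_extend_or_near_scalar[OF k(2) _ R] Suc.prems by auto
      then show ?thesis
        by blast
    qed
  qed
  then show thesis
    using that by blast
qed

section \<open>Size of annihilators\<close>

definition annihilator :: "nat \<Rightarrow> (nat \<Rightarrow> nat \<Rightarrow> 'b) \<Rightarrow> (nat \<Rightarrow> 'b) set" where
  "annihilator n w = {g \<in> V. \<forall>a<n. dot g (w a) = 0}"

lemma finite_annihilator: "finite (annihilator n w)"
  by (simp add: annihilator_def finite_V)

text \<open>Rank-nullity as an injection: a vector is determined by its values on the
  \<open>w a\<close> together with its projection to the annihilator. That projection uses the same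
  families with the roles of \<open>w\<close> and \<open>\<phi>\<close> exchanged.\<close>

lemma card_annihilator:
  assumes b: "biorth n w \<phi>" and n: "n \<le> l"
  shows "card K ^ (l - n) \<le> card (annihilator n w)"
proof -
  let ?f = "\<lambda>h. (proj n \<phi> w h, restrict (\<lambda>a. dot (w a) h) {..<n})"
  have b': "biorth n \<phi> w"
    using b by (auto simp: biorth_def dot_commute[of "w _"])
  have "inj_on ?f V"
  proof (rule inj_onI)
    fix g h assume "g \<in> V" "h \<in> V" and eq: "?f g = ?f h"
    have "restrict (\<lambda>a. dot (w a) g) {..<n} = restrict (\<lambda>a. dot (w a) h) {..<n}"
      using eq by simp
    from fun_cong[OF this] have d: "dot (w a) g = dot (w a) h" if "a < n" for a
      using that by (metis lessThan_iff restrict_apply')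
    show "g = h"
    proof
      fix i
      have "proj n \<phi> w g i = proj n \<phi> w h i"
        using eq by simp
      then show "g i = h i"
        by (simp add: proj_def d)
    qed
  qed
  moreover have "?f ` V \<subseteq> annihilator n w \<times> ({..<n} \<rightarrow>\<^sub>E K)"
    using proj_V[OF b'] dot_dual_proj[OF b'] dot_K biorth_V(1)[OF b]
    by (auto simp: annihilator_def dot_commute[of "proj _ _ _ _"] split: if_splits)
  ultimately have "card V \<le> card (annihilator n w \<times> ({..<n} \<rightarrow>\<^sub>E K))"
    by (rule card_inj_on_le) (simp add: finite_annihilator finite_PiE finite_K)
  then have "card K ^ (l - n) * card K ^ n \<le> card (annihilator n w) * card K ^ n"
    using n by (simp add: card_V card_cartesian_product card_PiE flip: power_add)
  then show ?thesis
    using card_K_ge by simp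
qed

section \<open>Symmetric forms and those invariant under an operator\<close>

definition Sym :: "(nat \<Rightarrow> nat \<Rightarrow> 'b) set" where
  "Sym = {A \<in> Mat. \<forall>i j. A i j = A j i}"

definition bil :: "(nat \<Rightarrow> nat \<Rightarrow> 'b) \<Rightarrow> (nat \<Rightarrow> 'b) \<Rightarrow> (nat \<Rightarrow> 'b) \<Rightarrow> 'b" where
  "bil A x y = dot x (app A y)"

definition isometric :: "(nat \<Rightarrow> nat \<Rightarrow> 'b) \<Rightarrow> (nat \<Rightarrow> nat \<Rightarrow> 'b) set" where
  "isometric R = {A \<in> Sym. \<forall>x\<in>V. \<forall>y\<in>V. bil A (app R x) (app R y) = bil A x y}"

lemma finite_Mat: "finite Mat"
proof -
  have "Mat \<subseteq> (\<lambda>f i. if i < l then f i else (\<lambda>j. 0)) ` ({..<l} \<rightarrow>\<^sub>E V)" (is "_ \<subseteq> ?g ` _")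
  proof
    fix A assume A: "A \<in> Mat"
    then have "A = ?g (restrict A {..<l})" "restrict A {..<l} \<in> {..<l} \<rightarrow>\<^sub>E V"
      by (auto simp: Mat_def V_def fun_eq_iff)
    then show "A \<in> ?g ` ({..<l} \<rightarrow>\<^sub>E V)"
      by blast
  qed
  then show ?thesis
    by (rule finite_subset) (simp add: finite_PiE finite_V)
qed

lemma finite_Sym: "finite Sym"
  by (simp add: Sym_def finite_Mat)

lemma bil_add: "bil (\<lambda>i j. A i j + B i j) x y = bil A x y + bil B x y"
  by (simp add: bil_def app_def[abs_def] dot_def distrib_left distrib_right sum.distrib)

lemma bil_sum_rank_two:
  "bil (\<lambda>i j. \<Sum>a\<in>S. f a i * g a j + g a i * f a j) x y =
     (\<Sum>a\<in>S. dot (f a) x * dot (g a) y + dot (g a) x * dot (f a) y)"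
proof -
  have "app (\<lambda>i j. \<Sum>a\<in>S. f a i * g a j + g a i * f a j) y =
      (\<lambda>i. \<Sum>a\<in>S. dot (g a) y * f a i + dot (f a) y * g a i)"
  proof
    fix i
    have "app (\<lambda>i j. \<Sum>a\<in>S. f a i * g a j + g a i * f a j) y i =
        (\<Sum>a\<in>S. \<Sum>j<l. (f a i * g a j + g a i * f a j) * y j)"
      unfolding app_def sum_distrib_right by (rule sum.swap)
    then show "app (\<lambda>i j. \<Sum>a\<in>S. f a i * g a j + g a i * f a j) y i =
        (\<Sum>a\<in>S. dot (g a) y * f a i + dot (f a) y * g a i)"
      by (simp add: dot_def sum_distrib_left sum_distrib_right sum.distrib algebra_simps)
  qed
  then have "bil (\<lambda>i j. \<Sum>a\<in>S. f a i * g a j + g a i * f a j) x y =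
      (\<Sum>a\<in>S. dot (g a) y * dot x (f a) + dot (f a) y * dot x (g a))"
    by (simp add: bil_def dot_linear)
  then show ?thesis
    by (simp add: dot_commute[of x] mult.commute)
qed

text \<open>The forms \<open>?E g\<close> perturb invariant forms injectively within
  \<open>Sym\<close>. They are built from the duals \<open>\<phi> (2 * a + 1)\<close> of the vectors
  \<open>R x\<close> and from \<open>k\<close> free vectors of the annihilator, which has at least
  \<open>card K ^ (l - 2 * k)\<close> elements.\<close>

lemma card_isometric:
  assumes ch: "chain R k w \<phi>" and k: "2 * k \<le> l" and R: "R \<in> Mat"
    and surj: "\<And>z. z \<in> V \<Longrightarrow> \<exists>y\<in>V. app R y = z"
  shows "card (isometric R) * card K ^ (k * (l - 2 * k)) \<le> card Sym"
proof -
  let ?G = "annihilator (2 * k) w"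
  let ?E = "\<lambda>g i j. \<Sum>a<k. \<phi> (2 * a + 1) i * g a j + g a i * \<phi> (2 * a + 1) j"
  let ?f = "\<lambda>(A, g) i j. A i j + ?E g i j"
  have b: "biorth (2 * k) w \<phi>" and wR: "\<And>a. a < k \<Longrightarrow> w (2 * a + 1) = app R (w (2 * a))"
    using ch by (auto simp: chain_def)
  have gV: "g a \<in> V" and gw: "\<And>c. c < 2 * k \<Longrightarrow> dot (g a) (w c) = 0"
    if "g \<in> {..<k} \<rightarrow>\<^sub>E ?G" "a < k" for g a
    using PiE_mem[OF that(1), of a] that(2) by (auto simp: annihilator_def)
  \<comment> \<open>Both linear forms in each summand vanish at \<open>w (2 * a)\<close>:
    \<open>g c\<close> by annihilation, \<open>\<phi> (2 * c + 1)\<close> by biorthogonality and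
    parity.\<close>
  have even: "bil (?E g) (w (2 * a)) y = 0" if "g \<in> {..<k} \<rightarrow>\<^sub>E ?G" "a < k" for g a y
    unfolding bil_sum_rank_two using that gw biorth_dot[OF b]
    by (intro sum.neutral) (auto, presburger)
  have odd: "bil (?E g) (w (2 * a + 1)) z = dot (g a) z"
    if g: "g \<in> {..<k} \<rightarrow>\<^sub>E ?G" and a: "a < k" and z: "z \<in> V" for g a z
  proof -
    have "bil (?E g) (w (2 * a + 1)) z = (\<Sum>c<k. if c = a then u * dot (g a) z else 0)"
      unfolding bil_sum_rank_two using g a gw biorth_dot[OF b] by (intro sum.cong) auto
    also have "\<dots> = dot (g a) z"
      using a dot_K[OF gV[OF g a] z] by simp
    finally show ?thesis .
  qed
  have "inj_on ?f (isometric R \<times> ({..<k} \<rightarrow>\<^sub>E ?G))"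
  proof (rule inj_onI, clarify)
    fix A g B h
    assume A: "A \<in> isometric R" and B: "B \<in> isometric R"
      and g: "g \<in> {..<k} \<rightarrow>\<^sub>E ?G" and h: "h \<in> {..<k} \<rightarrow>\<^sub>E ?G"
      and eq: "(\<lambda>i j. A i j + ?E g i j) = (\<lambda>i j. B i j + ?E h i j)"
    have bil_eq: "bil A x y + bil (?E g) x y = bil B x y + bil (?E h) x y" for x y
      using arg_cong[OF eq, of "\<lambda>M. bil M x y"] by (simp only: bil_add)
    have "g a = h a" if a: "a < k" for a
    proof -
      have wa: "w (2 * a) \<in> V"
        using biorth_V(1)[OF b] a by simp
      \<comment> \<open>The perturbations vanish at \<open>w (2 * a)\<close>, so \<open>A\<close>
        and \<open>B\<close> agree there. By invariance, with \<open>app R y = z\<close>, they also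
        agree at \<open>w (2 * a + 1)\<close> and \<open>z\<close>, and what remains of
        \<open>bil_eq\<close> is the equality of \<open>g a\<close> and \<open>h a\<close>.\<close>
      have gh: "dot (g a) z = dot (h a) z" if z: "z \<in> V" for z
      proof -
        obtain y where y: "y \<in> V" "app R y = z"
          using surj[OF z] by blast
        have "bil M (w (2 * a + 1)) z = bil M (w (2 * a)) y" if "M \<in> isometric R" for M
          using that wR[OF a] wa y by (auto simp: isometric_def)
        then show ?thesis
          using bil_eq[of "w (2 * a)" y] bil_eq[of "w (2 * a + 1)" z] even[OF g a] even[OF h a]
            odd[OF g a z] odd[OF h a z] A B by simp
      qed
      have "dot (\<lambda>i. g a i - h a i) z = 0" if "z \<in> V" for z
        using gh[OF that] by (simp add: dot_commute[of _ z] dot_linear)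
      then have "(\<lambda>i. g a i - h a i) = (\<lambda>i. 0)"
        using gV[OF g a] gV[OF h a] by (intro dot_nondegenerate V_diff) auto
      then show ?thesis
        by (simp add: fun_eq_iff)
    qed
    then have "g = h"
      using g h by (intro PiE_ext[of g "{..<k}" "\<lambda>_. ?G" h]) auto
    then show "A = B \<and> g = h"
      using eq by (auto simp: fun_eq_iff)
  qed
  moreover have "?f ` (isometric R \<times> ({..<k} \<rightarrow>\<^sub>E ?G)) \<subseteq> Sym"
  proof clarify
    fix A g assume A: "A \<in> isometric R" and g: "g \<in> {..<k} \<rightarrow>\<^sub>E ?G"
    have "?E g i j \<in> K" for i j
      using gV[OF g] biorth_V(2)[OF b] by (intro sum_K add_K mult_K V_K) auto
    moreover have "?E g i j = 0" if "l \<le> i \<or> l \<le> j" for i j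
      using that gV[OF g] biorth_V(2)[OF b] by (intro sum.neutral) (auto simp: V_outside)
    moreover have "?E g i j = ?E g j i" for i j
      by (simp add: algebra_simps)
    ultimately show "(\<lambda>i j. A i j + ?E g i j) \<in> Sym"
      using A by (auto simp: isometric_def Sym_def Mat_def intro!: add_K)
  qed
  ultimately have le: "card (isometric R \<times> ({..<k} \<rightarrow>\<^sub>E ?G)) \<le> card Sym"
    using finite_Sym by (rule card_inj_on_le)
  have "card (isometric R) * card K ^ (k * (l - 2 * k)) \<le> card (isometric R) * card ?G ^ k"
    using power_mono[OF card_annihilator[OF b k], of k]
    by (simp add: mult.commute flip: power_mult)
  also have "\<dots> \<le> card Sym"
    using le by (simp add: card_cartesian_product card_PiE)
  finally show ?thesis .
qed

end

section \<open>Embedding a carrier-based field into a type class\<close>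

text \<open>
  The product of all commutative rings with carrier in \<^typ>\<open>'a\<close> is a single type of class
  \<^class>\<open>comm_ring\<close> that contains every such field as a (non-unital) subring.
\<close>

typedef 'a cring_prod = "{f :: 'a ring \<Rightarrow> 'a. \<forall>F. if cring F then f F \<in> carrier F else f F = undefined}"
  by (rule exI[of _ "\<lambda>F. if cring F then \<zero>\<^bsub>F\<^esub> else undefined"])
    (auto intro: cring.cring_simprules)

setup_lifting type_definition_cring_prod

instantiation cring_prod :: (type) comm_ring
begin

lift_definition zero_cring_prod :: "'a cring_prod" is "\<lambda>F. if cring F then \<zero>\<^bsub>F\<^esub> else undefined"
  by (auto intro: cring.cring_simprules)

lift_definition plus_cring_prod :: "'a cring_prod \<Rightarrow> 'a cring_prod \<Rightarrow> 'a cring_prod"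
  is "\<lambda>f g F. if cring F then f F \<oplus>\<^bsub>F\<^esub> g F else undefined"
  by (auto intro: cring.cring_simprules)

lift_definition times_cring_prod :: "'a cring_prod \<Rightarrow> 'a cring_prod \<Rightarrow> 'a cring_prod"
  is "\<lambda>f g F. if cring F then f F \<otimes>\<^bsub>F\<^esub> g F else undefined"
  by (auto intro: cring.cring_simprules)

lift_definition uminus_cring_prod :: "'a cring_prod \<Rightarrow> 'a cring_prod"
  is "\<lambda>f F. if cring F then \<ominus>\<^bsub>F\<^esub> f F else undefined"
  by (auto intro: cring.cring_simprules)

lift_definition minus_cring_prod :: "'a cring_prod \<Rightarrow> 'a cring_prod \<Rightarrow> 'a cring_prod"
  is "\<lambda>f g F. if cring F then f F \<ominus>\<^bsub>F\<^esub> g F else undefined"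
  by (auto intro: cring.cring_simprules)

instance
proof
  fix a b c :: "'a cring_prod"
  show "a * b * c = a * (b * c)"
    by transfer (auto simp: fun_eq_iff cring.cring_simprules)
  show "a * b = b * a"
    by transfer (auto simp: fun_eq_iff cring.cring_simprules)
  show "a + b + c = a + (b + c)"
    by transfer (auto simp: fun_eq_iff cring.cring_simprules)
  show "a + b = b + a"
    by transfer (auto simp: fun_eq_iff cring.cring_simprules)
  show "0 + a = a"
    by transfer (auto simp: fun_eq_iff cring.cring_simprules)
  show "- a + a = 0"
    by transfer (auto simp: fun_eq_iff cring.cring_simprules)
  show "a - b = a + - b"
    by transfer (auto simp: fun_eq_iff a_minus_def)
  show "(a + b) * c = a * c + b * c"
    by transfer (auto simp: fun_eq_iff cring.cring_simprules)
qed

end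

text \<open>At most \<open>Q * d\<close> summands, each at most \<open>s / Q\<close>; the division
  is cleared to stay in the natural numbers.\<close>

lemma sum_le_mult_if_card_le:
  fixes f :: "'c \<Rightarrow> nat"
  assumes card: "card X \<le> Q * d" and f: "\<And>x. x \<in> X \<Longrightarrow> f x * Q \<le> s" and Q: "0 < Q"
  shows "sum f X \<le> d * s"
proof -
  have "sum f X * Q \<le> card X * s"
    using sum_bounded_above[of X "\<lambda>x. f x * Q" s] f by (simp add: sum_distrib_right)
  also have "\<dots> \<le> (d * s) * Q"
    using mult_right_mono[OF card, of s] by (simp add: algebra_simps)
  finally show ?thesis
    using Q by simp
qed

locale finite_field = field F for F :: "'a ring" (structure) +
  fixes l :: nat
  assumes finite_carrier: "finite (carrier F)"
begin

text \<open>The element concentrated in the factor belonging to \<open>F\<close>. The image of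
  \<open>\<one>\<close> is zero in all other factors, hence only an idempotent that acts as a unit
  on the copy of \<open>F\<close>.\<close>

definition single :: "'a \<Rightarrow> 'a cring_prod" where
  "single a = Abs_cring_prod (\<lambda>G. if cring G then if G = F then a else \<zero>\<^bsub>G\<^esub> else undefined)"

lemma Rep_single:
  assumes "a \<in> carrier F"
  shows "Rep_cring_prod (single a) = (\<lambda>G. if cring G then if G = F then a else \<zero>\<^bsub>G\<^esub> else undefined)"
  unfolding single_def
  by (rule Abs_cring_prod_inverse) (use assms in \<open>auto intro: cring.cring_simprules\<close>)

lemma inj_on_single: "inj_on single (carrier F)"
proof (rule inj_onI)
  fix a b assume "a \<in> carrier F" "b \<in> carrier F" "single a = single b"
  then show "a = b"
    using Rep_single[of a] Rep_single[of b] is_cring by (metis (no_types, lifting))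
qed

lemma single_zero: "single \<zero> = 0"
  by (rule Rep_cring_prod_inject[THEN iffD1]) (auto simp: Rep_single zero_cring_prod.rep_eq fun_eq_iff)

lemma single_add: "a \<in> carrier F \<Longrightarrow> b \<in> carrier F \<Longrightarrow> single (a \<oplus> b) = single a + single b"
  by (rule Rep_cring_prod_inject[THEN iffD1])
    (auto simp: Rep_single plus_cring_prod.rep_eq fun_eq_iff cring.cring_simprules)

lemma single_mult: "a \<in> carrier F \<Longrightarrow> b \<in> carrier F \<Longrightarrow> single (a \<otimes> b) = single a * single b"
  by (rule Rep_cring_prod_inject[THEN iffD1])
    (auto simp: Rep_single times_cring_prod.rep_eq fun_eq_iff cring.cring_simprules)

lemma single_uminus: "a \<in> carrier F \<Longrightarrow> single (\<ominus> a) = - single a"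
  using single_add[of "\<ominus> a" a] single_zero by (simp add: l_neg eq_neg_iff_add_eq_0)

lemma single_finsum:
  "finite A \<Longrightarrow> f \<in> A \<rightarrow> carrier F \<Longrightarrow> single (finsum F f A) = (\<Sum>x\<in>A. single (f x))"
  by (induction A rule: finite_induct) (auto simp: single_zero single_add)

sublocale emb: finite_field_subset "single ` carrier F" "single \<one>" l
proof
  show "finite (single ` carrier F)"
    using finite_carrier by simp
  show "0 \<in> single ` carrier F"
    using single_zero by (metis imageI zero_closed)
  show "single \<one> \<in> single ` carrier F"
    by simp
  show "single \<one> \<noteq> 0"
    using inj_onD[OF inj_on_single, of \<one> \<zero>] single_zero by auto
  fix x assume x: "x \<in> single ` carrier F"
  then show "- x \<in> single ` carrier F"
    by (auto simp flip: single_uminus)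
  show "single \<one> * x = x"
    using x by (auto simp flip: single_mult)
  {
    fix y assume "y \<in> single ` carrier F"
    with x show "x + y \<in> single ` carrier F"
      by (auto simp flip: single_add)
  }
  {
    fix y assume "y \<in> single ` carrier F"
    with x show "x * y \<in> single ` carrier F"
      by (auto simp flip: single_mult)
  }
  assume "x \<noteq> 0"
  then obtain a where a: "a \<in> carrier F" "a \<noteq> \<zero>" "x = single a"
    using x single_zero by auto
  then have "a \<in> Units F"
    by (simp add: field_Units)
  then have "single (inv a) * x = single \<one>" "inv a \<in> carrier F"
    using a by (auto simp flip: single_mult)
  then show "\<exists>y\<in>single ` carrier F. y * x = single \<one>"
    by blast
qed

section \<open>Transfer of matrices and their action on vectors\<close>

lemma card_single_carrier: "card (single ` carrier F) = card (carrier F)"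
  by (rule card_image) (rule inj_on_single)

definition embed :: "'a mat \<Rightarrow> nat \<Rightarrow> nat \<Rightarrow> 'a cring_prod" where
  "embed A i j = (if i < l \<and> j < l then single (A $$ (i, j)) else 0)"

lemma embed_Mat: "A \<in> mats F l \<Longrightarrow> embed A \<in> emb.Mat"
  by (auto simp: embed_def emb.Mat_def mats_def)

lemma inj_on_embed: "inj_on embed (mats F l)"
proof (rule inj_onI)
  fix A B assume A: "A \<in> mats F l" and B: "B \<in> mats F l" and eq: "embed A = embed B"
  show "A = B"
  proof (rule eq_matI)
    fix i j assume "i < dim_row B" "j < dim_col B"
    then have ij: "i < l" "j < l"
      using B by (auto simp: mats_def)
    then have "single (A $$ (i, j)) = single (B $$ (i, j))"
      using fun_cong[OF fun_cong[OF eq, of i], of j] by (simp add: embed_def)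
    then show "A $$ (i, j) = B $$ (i, j)"
      using A B ij inj_on_single by (auto simp: mats_def inj_on_def)
  qed (use A B in \<open>auto simp: mats_def\<close>)
qed

lemma transpose_mats: "A \<in> mats F l \<Longrightarrow> transpose_mat A \<in> mats F l"
  by (auto simp: mats_def)

lemma embed_transpose: "A \<in> mats F l \<Longrightarrow> embed (transpose_mat A) i j = embed A j i"
  by (auto simp: mats_def embed_def)

text \<open>Surjectivity comes from inverting \<open>single\<close> entry by entry. Equality makes
  the number of symmetric forms the same on both sides.\<close>

lemma embed_sym_mats: "embed ` sym_mats F l = emb.Sym"
proof
  show "embed ` sym_mats F l \<subseteq> emb.Sym"
    using embed_Mat embed_transpose unfolding sym_mats_def emb.Sym_def by force
  show "emb.Sym \<subseteq> embed ` sym_mats F l"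
  proof
    fix S assume S: "S \<in> emb.Sym"
    define A where "A = mat l l (\<lambda>(i, j). the_inv_into (carrier F) single (S i j))"
    have SK: "S i j \<in> single ` carrier F" for i j
      using S by (auto simp: emb.Sym_def emb.Mat_def)
    have "the_inv_into (carrier F) single (S i j) \<in> carrier F" for i j
      using the_inv_into_into[OF inj_on_single SK] by blast
    then have A: "A \<in> mats F l"
      by (auto simp: A_def mats_def)
    moreover have "transpose_mat A = A"
      using S by (auto simp: A_def emb.Sym_def intro!: eq_matI)
    moreover have "embed A = S"
      using S f_the_inv_into_f[OF inj_on_single SK]
      by (auto simp: embed_def A_def fun_eq_iff emb.Sym_def emb.Mat_def)
    ultimately show "S \<in> embed ` sym_mats F l"
      by (auto simp: sym_mats_def)
  qed
qed

lemma mmult_mats: "A \<in> mats F l \<Longrightarrow> B \<in> mats F l \<Longrightarrow> mmult F A B \<in> mats F l"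
  by (auto simp: mats_def mmult_def intro!: finsum_closed)

lemma embed_mmult:
  assumes "A \<in> mats F l" "B \<in> mats F l"
  shows "embed (mmult F A B) i j = (\<Sum>k<l. embed A i k * embed B k j)"
proof (cases "i < l \<and> j < l")
  case True
  have "single (\<Oplus>k\<in>{..<l}. A $$ (i, k) \<otimes> B $$ (k, j)) = (\<Sum>k<l. single (A $$ (i, k) \<otimes> B $$ (k, j)))"
    using assms True by (intro single_finsum) (auto simp: mats_def)
  also have "\<dots> = (\<Sum>k<l. embed A i k * embed B k j)"
    using assms True by (intro sum.cong) (auto simp: mats_def embed_def single_mult)
  finally have "single (\<Oplus>k\<in>{..<l}. A $$ (i, k) \<otimes> B $$ (k, j)) =
      (\<Sum>k<l. embed A i k * embed B k j)" .
  moreover have "dim_row A = l" "dim_col A = l" "dim_col B = l"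
    using assms by (auto simp: mats_def)
  ultimately show ?thesis
    using True by (simp add: embed_def mmult_def)
next
  case False
  then show ?thesis
    by (auto simp: embed_def)
qed

lemma app_embed_mmult:
  assumes "A \<in> mats F l" "B \<in> mats F l"
  shows "emb.app (embed (mmult F A B)) x = emb.app (embed A) (emb.app (embed B) x)"
proof
  fix i
  have "emb.app (embed (mmult F A B)) x i = (\<Sum>j<l. \<Sum>k<l. embed A i k * (embed B k j * x j))"
    by (simp add: emb.app_def embed_mmult[OF assms] sum_distrib_right mult.assoc)
  also have "\<dots> = (\<Sum>k<l. \<Sum>j<l. embed A i k * (embed B k j * x j))"
    by (rule sum.swap)
  finally show "emb.app (embed (mmult F A B)) x i = emb.app (embed A) (emb.app (embed B) x) i"
    by (simp add: emb.app_def sum_distrib_left)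
qed

lemma dot_app_embed:
  assumes "A \<in> mats F l"
  shows "emb.dot (emb.app (embed A) x) y = emb.dot x (emb.app (embed (transpose_mat A)) y)"
proof -
  have "emb.dot (emb.app (embed A) x) y = (\<Sum>i<l. \<Sum>j<l. embed A i j * x j * y i)"
    by (simp add: emb.dot_def emb.app_def sum_distrib_right)
  also have "\<dots> = (\<Sum>j<l. \<Sum>i<l. embed A i j * x j * y i)"
    by (rule sum.swap)
  finally show ?thesis
    by (simp add: emb.dot_def emb.app_def sum_distrib_left embed_transpose[OF assms] ac_simps)
qed

definition fixed_forms :: "'a mat \<Rightarrow> 'a mat set" where
  "fixed_forms R = {C \<in> sym_mats F l. mmult F (mmult F (transpose_mat R) C) R = C}"

text \<open>Moving \<open>R\<close> across \<open>dot\<close> as its transpose turns the form at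
  \<open>R x\<close>, \<open>R y\<close> into the form of the congruent matrix at \<open>x\<close>,
  \<open>y\<close>.\<close>

lemma embed_fixed_forms:
  assumes R: "R \<in> mats F l"
  shows "embed ` fixed_forms R \<subseteq> emb.isometric (embed R)"
proof
  fix S assume "S \<in> embed ` fixed_forms R"
  then obtain C where C: "S = embed C" "C \<in> sym_mats F l" "mmult F (mmult F (transpose_mat R) C) R = C"
    by (auto simp: fixed_forms_def)
  then have Cm: "C \<in> mats F l"
    by (simp add: sym_mats_def)
  have "emb.bil (embed C) (emb.app (embed R) x) (emb.app (embed R) y) = emb.bil (embed C) x y" for x y
  proof -
    have "emb.bil (embed C) (emb.app (embed R) x) (emb.app (embed R) y) =
        emb.dot x (emb.app (embed (mmult F (mmult F (transpose_mat R) C) R)) y)"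
      by (simp add: emb.bil_def dot_app_embed app_embed_mmult R Cm transpose_mats mmult_mats)
    then show ?thesis
      by (simp add: C(3) emb.bil_def)
  qed
  then show "S \<in> emb.isometric (embed R)"
    using C embed_sym_mats by (auto simp: emb.isometric_def)
qed

text \<open>A right inverse \<open>T\<close> of \<open>R\<close> provides the preimage of
  \<open>z\<close>, namely \<open>T\<close> applied to \<open>z\<close>.\<close>

lemma app_embed_surj:
  assumes R: "R \<in> GL F l" and z: "z \<in> emb.V"
  shows "\<exists>y\<in>emb.V. emb.app (embed R) y = z"
proof -
  obtain T where T: "T \<in> mats F l" "mmult F R T = mone F l" and Rm: "R \<in> mats F l"
    using R by (auto simp: GL_def)
  have "emb.app (embed R) (emb.app (embed T) z) = emb.app (embed (mone F l)) z"
    by (simp add: app_embed_mmult[OF Rm T(1), symmetric] T(2))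
  also have "\<dots> = z"
  proof
    fix i
    show "emb.app (embed (mone F l)) z i = z i"
    proof (cases "i < l")
      case True
      have "emb.app (embed (mone F l)) z i = (\<Sum>j<l. if j = i then single \<one> * z i else 0)"
        unfolding emb.app_def
        using True by (intro sum.cong) (auto simp: embed_def mone_def single_zero)
      then show ?thesis
        using True emb.V_K[OF z] by simp
    next
      case False
      then show ?thesis
        using emb.V_outside[OF z, of i] by (simp add: emb.app_def embed_def)
    qed
  qed
  finally show ?thesis
    using emb.app_V[OF embed_Mat[OF T(1)] z] by blast
qed

section \<open>Counting matrices and fixed forms over the given field\<close>

lemma mats_subset_image: "mats F l \<subseteq> mat l l ` (({..<l} \<times> {..<l}) \<rightarrow>\<^sub>E carrier F)"
proof
  fix A assume A: "A \<in> mats F l"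
  then have "A = mat l l (restrict (\<lambda>ij. A $$ ij) ({..<l} \<times> {..<l}))"
    by (intro eq_matI) (auto simp: mats_def)
  moreover have "restrict (\<lambda>ij. A $$ ij) ({..<l} \<times> {..<l}) \<in> ({..<l} \<times> {..<l}) \<rightarrow>\<^sub>E carrier F"
    using A by (auto simp: mats_def)
  ultimately show "A \<in> mat l l ` (({..<l} \<times> {..<l}) \<rightarrow>\<^sub>E carrier F)"
    by blast
qed

lemma finite_mats: "finite (mats F l)"
  by (rule finite_subset[OF mats_subset_image]) (simp add: finite_PiE finite_carrier)

lemma card_mats_le: "card (mats F l) \<le> card (carrier F) ^ (l * l)"
  using surj_card_le[OF _ mats_subset_image]
  by (simp add: finite_PiE finite_carrier card_PiE card_cartesian_product)

definition near_scalar_mats :: "nat \<Rightarrow> 'a mat set" where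
  "near_scalar_mats k = {R \<in> mats F l. embed R \<in> emb.near_scalar (2 * k)}"

lemma card_near_scalar_mats: "card (near_scalar_mats k) \<le> card (carrier F) ^ (1 + 4 * k * l)"
proof -
  have "card (near_scalar_mats k) \<le> card (emb.near_scalar (2 * k))"
    by (rule card_inj_on_le[of embed])
      (auto simp: near_scalar_mats_def emb.finite_near_scalar intro: inj_on_subset[OF inj_on_embed])
  also have "\<dots> \<le> card (carrier F) ^ (1 + 4 * k * l)"
    using emb.card_near_scalar[of "2 * k"] by (simp add: card_single_carrier)
  finally show ?thesis .
qed

text \<open>Carries \<open>chain_maximal\<close> and \<open>card_isometric\<close> back to matrices
  over \<open>F\<close>; injectivity of \<open>embed\<close> transfers the cardinalities.\<close>

lemma fixed_forms_dichotomy: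
  assumes R: "R \<in> GL F l" and m: "4 * m \<le> l"
  obtains k where "k \<le> m" "k = m \<or> R \<in> near_scalar_mats k"
    "card (fixed_forms R) * card (carrier F) ^ (k * (l - 2 * k)) \<le> card (sym_mats F l)"
proof -
  have Rm: "R \<in> mats F l"
    using R by (simp add: GL_def)
  obtain k w \<phi> where k: "k \<le> m" "emb.chain (embed R) k w \<phi>"
      "k = m \<or> embed R \<in> emb.near_scalar (2 * k)"
    using emb.chain_maximal[OF embed_Mat[OF Rm] m] by blast
  have "card (emb.isometric (embed R)) * card (carrier F) ^ (k * (l - 2 * k)) \<le> card emb.Sym"
    using emb.card_isometric[OF k(2) _ embed_Mat[OF Rm] app_embed_surj[OF R]] k(1) m
    by (simp add: card_single_carrier)
  moreover have "card emb.Sym = card (sym_mats F l)"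
    unfolding embed_sym_mats[symmetric]
    by (rule card_image) (rule inj_on_subset[OF inj_on_embed], auto simp: sym_mats_def)
  moreover have "card (fixed_forms R) \<le> card (emb.isometric (embed R))"
  proof (rule card_inj_on_le[OF _ embed_fixed_forms[OF Rm]])
    show "inj_on embed (fixed_forms R)"
      by (rule inj_on_subset[OF inj_on_embed]) (auto simp: fixed_forms_def sym_mats_def)
    show "finite (emb.isometric (embed R))"
      by (simp add: emb.isometric_def emb.finite_Sym)
  qed
  ultimately have "card (fixed_forms R) * card (carrier F) ^ (k * (l - 2 * k)) \<le> card (sym_mats F l)"
    by (metis (no_types, lifting) le_trans mult_le_mono1)
  then show thesis
    using that k Rm by (auto simp: near_scalar_mats_def)
qed

section \<open>Counting automorphisms\<close>

lemma card_carrier_ge: "2 \<le> card (carrier F)"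
  using emb.card_K_ge by (simp add: card_single_carrier)

lemma finite_sym_mats: "finite (sym_mats F l)"
  using finite_mats by (simp add: sym_mats_def)

lemma finite_GL: "finite (GL F l)"
  using finite_mats by (simp add: GL_def)

text \<open>The matrices are grouped by chain length \<open>k \<le> l div 4\<close>. Each group
  contributes at most \<open>q ^ 9 * s ^ 8\<close>, and the number of groups costs the remaining
  factor \<open>q ^ (l div 4)\<close>.\<close>

lemma sum_fixed_forms_le:
  "(\<Sum>R\<in>GL F l. card (fixed_forms R) ^ 8) \<le> card (carrier F) ^ (l div 4 + 9) * card (sym_mats F l) ^ 8"
proof -
  define q where "q = card (carrier F)"
  define s where "s = card (sym_mats F l)"
  define m where "m = l div 4"
  have q: "2 \<le> q"
    using card_carrier_ge by (simp add: q_def)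
  have m: "4 * m \<le> l"
    by (simp add: m_def)
  have "\<exists>k. k \<le> m \<and> (k = m \<or> R \<in> near_scalar_mats k) \<and>
      card (fixed_forms R) * q ^ (k * (l - 2 * k)) \<le> s" if "R \<in> GL F l" for R
    using fixed_forms_dichotomy[OF that m] unfolding q_def s_def by blast
  then obtain \<kappa> where \<kappa>: "\<And>R. R \<in> GL F l \<Longrightarrow> \<kappa> R \<le> m"
    "\<And>R. R \<in> GL F l \<Longrightarrow> \<kappa> R = m \<or> R \<in> near_scalar_mats (\<kappa> R)"
    "\<And>R. R \<in> GL F l \<Longrightarrow> card (fixed_forms R) * q ^ (\<kappa> R * (l - 2 * \<kappa> R)) \<le> s"
    by metis
  have pow: "card (fixed_forms R) ^ 8 * q ^ (8 * (\<kappa> R * (l - 2 * \<kappa> R))) \<le> s ^ 8" if "R \<in> GL F l" for R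
    using power_mono[OF \<kappa>(3)[OF that], of 8]
    by (simp add: power_mult_distrib mult.commute flip: power_mult)
  have part: "(\<Sum>R\<in>{R \<in> GL F l. \<kappa> R = k}. card (fixed_forms R) ^ 8) \<le> q ^ 9 * s ^ 8"
    if k: "k \<le> m" for k
  proof (cases "k = m")
    case True
    \<comment> \<open>With \<open>l = 4 * m + r\<close>, the difference of \<open>l * l\<close> and
      \<open>8 * (m * (l - 2 * m))\<close> is exactly \<open>r * r\<close>, and
      \<open>r \<le> 3\<close>. This is the origin of the 9.\<close>
    have "l = 4 * m + l mod 4" "l mod 4 * (l mod 4) \<le> 3 * 3"
      using mult_le_mono[of "l mod 4" 3 "l mod 4" 3] by (simp_all add: m_def)
    then obtain r where r: "l = 4 * m + r" "r * r \<le> 9"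
      by auto
    have l2: "l * l \<le> 8 * (m * (l - 2 * m)) + 9"
      using r by (simp add: algebra_simps)
    have "(\<Sum>R\<in>{R \<in> GL F l. \<kappa> R = k}. card (fixed_forms R) ^ 8) \<le> 1 * (q ^ 9 * s ^ 8)"
    proof (rule sum_le_mult_if_card_le)
      show "card {R \<in> GL F l. \<kappa> R = k} \<le> q ^ (l * l) * 1"
        using card_mats_le card_mono[OF finite_mats, of "{R \<in> GL F l. \<kappa> R = k}"]
        by (auto simp: GL_def q_def)
      fix R assume "R \<in> {R \<in> GL F l. \<kappa> R = k}"
      then have R: "R \<in> GL F l" "\<kappa> R = m"
        using True by auto
      have "card (fixed_forms R) ^ 8 * q ^ (l * l) \<le>
          card (fixed_forms R) ^ 8 * q ^ (8 * (m * (l - 2 * m)) + 9)"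
        using q l2 by (intro mult_left_mono power_increasing) auto
      also have "\<dots> \<le> q ^ 9 * s ^ 8"
        using pow[OF R(1)] by (simp add: R(2) power_add)
      finally show "card (fixed_forms R) ^ 8 * q ^ (l * l) \<le> q ^ 9 * s ^ 8" .
    qed (use q in simp)
    then show ?thesis
      by simp
  next
    case False
    have "(\<Sum>R\<in>{R \<in> GL F l. \<kappa> R = k}. card (fixed_forms R) ^ 8) \<le> q * s ^ 8"
    proof (rule sum_le_mult_if_card_le)
      have "{R \<in> GL F l. \<kappa> R = k} \<subseteq> near_scalar_mats k"
        using \<kappa>(2) False by auto
      then have "card {R \<in> GL F l. \<kappa> R = k} \<le> card (near_scalar_mats k)"
        by (intro card_mono) (auto simp: near_scalar_mats_def finite_mats)
      then show "card {R \<in> GL F l. \<kappa> R = k} \<le> q ^ (4 * k * l) * q"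
        using card_near_scalar_mats[of k] by (simp add: q_def mult.commute)
      fix R assume "R \<in> {R \<in> GL F l. \<kappa> R = k}"
      then have R: "R \<in> GL F l" "\<kappa> R = k"
        by auto
      \<comment> \<open>The difference of the two exponents is \<open>4 * k * (l - 4 * k)\<close>,
        which is \<open>4 * k * d\<close>.\<close>
      obtain d where "l = 4 * k + d"
        using k m le_Suc_ex[of "4 * k" l] by auto
      then have "4 * k * l \<le> 8 * (k * (l - 2 * k))"
        by (simp add: algebra_simps)
      then have "card (fixed_forms R) ^ 8 * q ^ (4 * k * l) \<le>
          card (fixed_forms R) ^ 8 * q ^ (8 * (k * (l - 2 * k)))"
        using q by (intro mult_left_mono power_increasing) auto
      also have "\<dots> \<le> s ^ 8"
        using pow[OF R(1)] by (simp add: R(2))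
      finally show "card (fixed_forms R) ^ 8 * q ^ (4 * k * l) \<le> s ^ 8" .
    qed (use q in simp)
    also have "\<dots> \<le> q ^ 9 * s ^ 8"
      using q power_increasing[of 1 9 q] by (intro mult_right_mono) auto
    finally show ?thesis .
  qed
  have "(\<Sum>R\<in>GL F l. card (fixed_forms R) ^ 8) =
      (\<Sum>k\<le>m. \<Sum>R\<in>{R \<in> GL F l. \<kappa> R = k}. card (fixed_forms R) ^ 8)"
    using \<kappa>(1) by (intro sum.group[symmetric] finite_GL) auto
  also have "\<dots> \<le> (\<Sum>k\<le>m. q ^ 9 * s ^ 8)"
    using part by (intro sum_mono) auto
  also have "\<dots> = (m + 1) * (q ^ 9 * s ^ 8)"
    by simp
  \<comment> \<open>The \<open>m + 1\<close> groups are absorbed by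
    \<open>m + 1 \<le> 2 ^ m \<le> q ^ m\<close>.\<close>
  also have "\<dots> \<le> q ^ m * (q ^ 9 * s ^ 8)"
  proof (rule mult_right_mono)
    have "m + 1 \<le> 2 ^ m"
      using Suc_leI[OF less_exp[of m]] by simp
    also have "\<dots> \<le> q ^ m"
      using q by (rule power_mono) simp
    finally show "m + 1 \<le> q ^ m" .
  qed simp
  finally show ?thesis
    by (simp add: q_def s_def m_def power_add algebra_simps)
qed

text \<open>Double counting of the pairs of a tuple and an automorphism. For fixed \<open>R\<close>
  the eight entries of the tuple range independently over \<open>fixed_forms R\<close>.\<close>

lemma sum_card_Aut:
  "(\<Sum>C\<in>sym_tuples F l. card (Aut F l C)) = (\<Sum>R\<in>GL F l. card (fixed_forms R) ^ 8)"
proof -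
  let ?P = "\<lambda>R C. \<forall>i\<in>{1..8}. mmult F (mmult F (transpose_mat R) (C i)) R = C i"
  have fin: "finite (sym_tuples F l)"
    by (simp add: sym_tuples_def finite_PiE finite_sym_mats)
  have "(\<Sum>C\<in>sym_tuples F l. card (Aut F l C)) = (\<Sum>C\<in>sym_tuples F l. \<Sum>R | R \<in> GL F l \<and> ?P R C. 1)"
    by (simp add: Aut_def)
  also have "\<dots> = (\<Sum>R\<in>GL F l. \<Sum>C | C \<in> sym_tuples F l \<and> ?P R C. 1)"
    by (rule sum.swap_restrict[OF fin finite_GL])
  also have "\<dots> = (\<Sum>R\<in>GL F l. card (fixed_forms R) ^ 8)"
  proof (rule sum.cong[OF refl])
    fix R
    have "{C. C \<in> sym_tuples F l \<and> ?P R C} = {1..8} \<rightarrow>\<^sub>E fixed_forms R"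
      unfolding sym_tuples_def fixed_forms_def PiE_iff set_eq_iff by blast
    then show "(\<Sum>C | C \<in> sym_tuples F l \<and> ?P R C. 1) = card (fixed_forms R) ^ 8"
      by (simp add: card_PiE)
  qed
  finally show ?thesis .
qed

text \<open>Markov's inequality with denominators cleared: each exceptional tuple contributes more
  than \<open>q ^ l\<close> to the sum of all \<open>card (Aut F l C)\<close>.\<close>

lemma card_large_Aut_le:
  "card {C \<in> sym_tuples F l. \<not> card (Aut F l C) \<le> card (carrier F) ^ l} * card (carrier F) ^ l
     \<le> card (carrier F) ^ (l div 4 + 9) * card (sym_tuples F l)"
proof -
  let ?T = "sym_tuples F l" and ?q = "card (carrier F)"
  let ?B = "{C \<in> ?T. \<not> card (Aut F l C) \<le> ?q ^ l}"
  have fin: "finite ?T"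
    by (simp add: sym_tuples_def finite_PiE finite_sym_mats)
  have "card ?B * ?q ^ l = (\<Sum>C\<in>?B. ?q ^ l)"
    by simp
  also have "\<dots> \<le> (\<Sum>C\<in>?B. card (Aut F l C))"
    by (rule sum_mono) auto
  also have "\<dots> \<le> (\<Sum>C\<in>?T. card (Aut F l C))"
    using fin by (intro sum_mono2) auto
  also have "\<dots> \<le> ?q ^ (l div 4 + 9) * card (sym_mats F l) ^ 8"
    unfolding sum_card_Aut by (rule sum_fixed_forms_le)
  also have "card (sym_mats F l) ^ 8 = card ?T"
    by (simp add: sym_tuples_def card_PiE)
  finally show ?thesis .
qed

lemma fraction_large_Aut_le:
  assumes l: "36 \<le> l"
  shows "real (card {C \<in> sym_tuples F l. \<not> card (Aut F l C) \<le> card (carrier F) ^ l})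
      / real (card (sym_tuples F l)) \<le> 1 / real (card (carrier F)) powr (1 / 2 * real l)"
    (is "?b / ?t \<le> 1 / ?q powr _")
proof -
  have q: "2 \<le> ?q"
    using card_carrier_ge by simp
  have "real (card {C \<in> sym_tuples F l. \<not> card (Aut F l C) \<le> card (carrier F) ^ l} * card (carrier F) ^ l)
      \<le> real (card (carrier F) ^ (l div 4 + 9) * card (sym_tuples F l))"
    using card_large_Aut_le by (rule of_nat_mono)
  then have "?b * ?q ^ l \<le> ?q ^ (l div 4 + 9) * ?t"
    by simp
  then have "?b / ?t \<le> ?q ^ (l div 4 + 9) / ?q ^ l"
    \<comment> \<open>For \<open>?t = 0\<close> the left side is 0, as division by zero yields
      zero.\<close>
    using q by (cases "?t = 0") (simp_all add: field_simps)
  also have "\<dots> = ?q powr (real (l div 4 + 9) - real l)"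
    using q by (simp add: powr_diff powr_realpow del: of_nat_add)
  \<comment> \<open>The exponent is at most \<open>l / 4 + 9 - l\<close>, and
    \<open>36 \<le> l\<close> gives \<open>9 \<le> l / 4\<close>.\<close>
  also have "\<dots> \<le> ?q powr (- (1 / 2 * real l))"
    using q l by (intro powr_mono) (auto simp: field_simps)
  also have "\<dots> = 1 / ?q powr (1 / 2 * real l)"
    by (simp add: powr_minus_divide)
  finally show ?thesis .
qed

end

theorem lemma3p2:
  shows "\<exists>c::real. c > 0 \<and> (\<exists>l0::nat. \<forall>F::'a ring. field F \<and> finite (carrier F) \<longrightarrow>
    (\<forall>l\<ge>l0. let q = card (carrier F) in
      real (card {C \<in> sym_tuples F l. \<not> card (Aut F l C) \<le> q ^ l}) / real (card (sym_tuples F l))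
        \<le> 1 / real q powr (c * real l)))"
\<comment> \<open>The witnesses \<open>1 / 2\<close> and \<open>36\<close> are chosen before
  \<open>F\<close>, so they depend neither on the field nor on its size.\<close>
proof (intro exI[of _ "1 / 2 :: real"] exI[of _ 36] conjI allI impI)
  fix F :: "'a ring" and l :: nat
  assume F: "field F \<and> finite (carrier F)" and l: "36 \<le> l"
  interpret finite_field F l
    using F by (simp add: finite_field_def finite_field_axioms_def)
  show "let q = card (carrier F) in
      real (card {C \<in> sym_tuples F l. \<not> card (Aut F l C) \<le> q ^ l}) / real (card (sym_tuples F l))
        \<le> 1 / real q powr (1 / 2 * real l)"
    unfolding Let_def by (rule fraction_large_Aut_le[OF l])
qed simp

end
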